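(* Assume that $\mathbf{P}_\eta(L_i\ne L_j,\ \forall i\ne j)=1$ for all $\eta\in\{0,1\}^d$ with $|\eta|_0=s$. Let $\pi$ be the uniform distribution on $\{\eta\in\{0,1\}^d:|\eta|_0=s\}$ and $\mathbb{E}_\pi$ the expectation over $\eta\sim\pi$. Then $$\inf_{\tilde{\eta}} \sup_{|\eta|_{0} = s}\mathbf{P}_\eta(S_{\tilde\eta} \ne S_\eta) = \sup_{|\eta|_{0} = s}\mathbf{P}_\eta(S_{\hat{\eta}^{(s)}} \ne S_\eta)= \mathbf{P}_{e(s)}(S_{\hat{\eta}^{(s)}} \ne S_{e(s)}),$$ $$\inf_{\tilde{\eta}} \ \mathbb{E}_{\pi}\mathbf{P}_\eta(S_{\tilde\eta} \ne S_\eta) = \mathbb{E}_{\pi}\mathbf{P}_\eta(S_{\hat{\eta}^{(s)}} \ne S_\eta)= \mathbf{P}_{e(s)}(S_{\hat{\eta}^{(s)}} \ne S_{e(s)}),$$ where $\hat\eta^{(s)}$ is the scan selector and $e(s)=(1,\dots,1,0,\dots,0)$ is the vector with $s$ ones followed by $d-s$ zeros. Moreover, $$\mathbf{P}_{e(s)}(S_{\hat{\eta}^{(s)}} \ne S_{e(s)})= \mathbf{P}_{e(s)}\Big(\bigcup_{i=1}^s \{L_{i} \notin \mathbb{L}_{1:s}\}\Big).$$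
   Context: Pivotal selection problem: $d>2$ and $1\le s<d$ are integers; $P_0\neq P_1$ are probability measures on a measurable space with densities $f_0,f_1$ with respect to a common dominating measure $\mu$. For $\eta\in\{0,1\}^d$, under $\mathbf{P}_\eta$ the observations $X_1,\dots,X_d$ are independent, with $X_j\sim P_1$ if $\eta_j=1$ and $X_j\sim P_0$ if $\eta_j=0$. A selector is any measurable function $\tilde\eta=\tilde\eta(X_1,\dots,X_d,\zeta)$ with values in $\{0,1\}^d$, where $\zeta$ is a randomization variable independent of $(X_1,\dots,X_d)$ (and included in $\mathbf{P}_\eta$); $\inf_{\tilde\eta}$ is over all selectors. $S_\eta=\{j:\eta_j\ne0\}$ denotes the support of $\eta$; $|\eta|_0=|S_\eta|$; $\sup_{|\eta|_0=s}$ is over $\eta\in\{0,1\}^d$ with $|\eta|_0=s$. Likelihood ratios $L_i=\frac{f_1}{f_0}(X_i)$ are assumed to be well defined $\mathbf{P}_\eta$-a.s. for any $\eta$ (this is the case if the support of $f_1$ is included in the support of $f_0$). Let $L_{(1)}\ge\dots\ge L_{(d)}$ be the ordered values of $L_1,\dots,L_d$ and $\mathbb{L}_{1:s}=\{L_{(1)},\dots,L_{(s)}\}$. The scan selector is $\hat\eta^{(s)}$ with components $\hat\eta^{(s)}_i=\mathbf{1}(L_i\in\mathbb{L}_{1:s})$, $i=1,\dots,d$. *)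

theory Defs
  imports "HOL-Probability.Probability"
begin

text \<open>A vector of \<open>{0,1}\<^sup>d\<close> is an extensional function on the index set \<open>{1..d}\<close>.\<close>

definition binary_vectors :: "nat \<Rightarrow> (nat \<Rightarrow> nat) set" where
  "binary_vectors d = {1..d} \<rightarrow>\<^sub>E {0, 1}"

definition supp :: "nat \<Rightarrow> (nat \<Rightarrow> nat) \<Rightarrow> nat set" where
  "supp d \<eta> = {j \<in> {1..d}. \<eta> j \<noteq> 0}"

definition sparse_vectors :: "nat \<Rightarrow> nat \<Rightarrow> (nat \<Rightarrow> nat) set" where
  "sparse_vectors d s = {\<eta> \<in> binary_vectors d. card (supp d \<eta>) = s}"

definition first_ones :: "nat \<Rightarrow> nat \<Rightarrow> nat \<Rightarrow> nat" where
  "first_ones d s = (\<lambda>j\<in>{1..d}. if j \<le> s then 1 else 0)"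

text \<open>The joint law of \<open>((X\<^sub>1, \<dots>, X\<^sub>d), \<zeta>)\<close> under \<open>P\<^sub>\<eta>\<close>, where \<open>Z\<close> is the law of the randomization
  variable \<open>\<zeta>\<close>. A sample point is a pair \<open>\<omega>\<close>, with \<open>X\<^sub>i = fst \<omega> i\<close> and \<open>\<zeta> = snd \<omega>\<close>.\<close>

definition obs_law ::
    "'a measure \<Rightarrow> 'a measure \<Rightarrow> 'z measure \<Rightarrow> nat \<Rightarrow> (nat \<Rightarrow> nat) \<Rightarrow> ((nat \<Rightarrow> 'a) \<times> 'z) measure" where
  "obs_law P0 P1 Z d \<eta> = (\<Pi>\<^sub>M j\<in>{1..d}. if \<eta> j = 1 then P1 else P0) \<Otimes>\<^sub>M Z"

text \<open>Only the \<open>\<sigma>\<close>-algebra of \<open>M\<close> matters here.\<close>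

definition selectors ::
    "'a measure \<Rightarrow> 'z measure \<Rightarrow> nat \<Rightarrow> ((nat \<Rightarrow> 'a) \<times> 'z \<Rightarrow> (nat \<Rightarrow> nat)) set" where
  "selectors M Z d = ((\<Pi>\<^sub>M j\<in>{1..d}. M) \<Otimes>\<^sub>M Z) \<rightarrow>\<^sub>M count_space (binary_vectors d)"

definition error_prob ::
    "'a measure \<Rightarrow> 'a measure \<Rightarrow> 'z measure \<Rightarrow> nat \<Rightarrow> ((nat \<Rightarrow> 'a) \<times> 'z \<Rightarrow> (nat \<Rightarrow> nat)) \<Rightarrow>
      (nat \<Rightarrow> nat) \<Rightarrow> real" where
  "error_prob P0 P1 Z d h \<eta> = \<P>(\<omega> in obs_law P0 P1 Z d \<eta>. supp d (h \<omega>) \<noteq> supp d \<eta>)"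

text \<open>Where \<open>f0\<close> vanishes the quotient is the junk value \<open>0\<close>; statements about \<open>lik_ratio\<close> have to
  assume that this happens with probability zero.\<close>

definition lik_ratio ::
    "('a \<Rightarrow> real) \<Rightarrow> ('a \<Rightarrow> real) \<Rightarrow> nat \<Rightarrow> (nat \<Rightarrow> 'a) \<times> 'z \<Rightarrow> real" where
  "lik_ratio f0 f1 i \<omega> = f1 (fst \<omega> i) / f0 (fst \<omega> i)"

definition ordered_lik_ratio ::
    "('a \<Rightarrow> real) \<Rightarrow> ('a \<Rightarrow> real) \<Rightarrow> nat \<Rightarrow> nat \<Rightarrow> (nat \<Rightarrow> 'a) \<times> 'z \<Rightarrow> real" where
  "ordered_lik_ratio f0 f1 d k \<omega> =
     rev (sort (map (\<lambda>i. lik_ratio f0 f1 i \<omega>) [1..<Suc d])) ! (k - 1)"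

definition top_lik_ratios ::
    "('a \<Rightarrow> real) \<Rightarrow> ('a \<Rightarrow> real) \<Rightarrow> nat \<Rightarrow> nat \<Rightarrow> (nat \<Rightarrow> 'a) \<times> 'z \<Rightarrow> real set" where
  "top_lik_ratios f0 f1 d s \<omega> = (\<lambda>k. ordered_lik_ratio f0 f1 d k \<omega>) ` {1..s}"

definition scan_selector ::
    "('a \<Rightarrow> real) \<Rightarrow> ('a \<Rightarrow> real) \<Rightarrow> nat \<Rightarrow> nat \<Rightarrow> (nat \<Rightarrow> 'a) \<times> 'z \<Rightarrow> (nat \<Rightarrow> nat)" where
  "scan_selector f0 f1 d s \<omega> =
     (\<lambda>i\<in>{1..d}. if lik_ratio f0 f1 i \<omega> \<in> top_lik_ratios f0 f1 d s \<omega> then 1 else 0)"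

end

theory Submission
  imports Defs
begin

text \<open>With \<open>P\<^sub>1 = L \<cdot> P\<^sub>0\<close>, the law under \<open>\<eta>\<close> has density \<open>\<Prod>\<^bsub>i\<in>S\<^esub> L\<^sub>i\<close> (with \<open>S\<close> the support of \<open>\<eta>\<close>)
  with respect to the null law, so the sum over \<open>s\<close>-sparse \<open>\<eta>\<close> of the probabilities of exact recovery is
  the integral of the density at the selected vector. In the absence of ties the scan selector
  maximizes this integrand pointwise, and almost everywhere on the ties the densities of all sparse
  vectors vanish; hence it is Bayes for the uniform prior. Since its risk is constant by
  permutation symmetry, it is also minimax.\<close>

section \<open>Ranks and the indices of the largest values\<close>

text \<open>In a decreasing list the entries above \<open>x\<close> come first and the copies of
  \<open>x\<close>, if any, follow at once, so the first copy sits at the position given by the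
  number of strictly larger entries. The strict count makes repeated values harmless.\<close>

lemma mem_set_take_decreasing:
  fixes x :: "'b::linorder"
  assumes "sorted_wrt (\<ge>) ys"
  shows "x \<in> set (take s ys) \<longleftrightarrow> x \<in> set ys \<and> length (filter (\<lambda>y. x < y) ys) < s"
  using assms
proof (induction ys arbitrary: s)
  case (Cons y ys)
  show ?case
  proof (cases s)
    case (Suc s')
    have le: "\<And>z. z \<in> set ys \<Longrightarrow> z \<le> y"
      using Cons.prems by auto
    have IH: "x \<in> set (take s' ys) \<longleftrightarrow> x \<in> set ys \<and> length (filter (\<lambda>y. x < y) ys) < s'"
      using Cons by auto
    consider "x = y" | "x < y" | "y < x" by force
    then show ?thesis
    proof cases
      case 1
      then have "filter (\<lambda>y. x < y) ys = []"
        using le by (auto simp: filter_empty_conv not_less)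
      then show ?thesis using 1 Suc by simp
    next
      case 2
      then show ?thesis using IH Suc by auto
    next
      case 3
      then have "x \<notin> set ys" using le by force
      then show ?thesis using 3 Suc by (auto dest: in_set_takeD)
    qed
  qed simp
qed simp

text \<open>The rank counts strictly larger values, so tied indices are kept or dropped together and
  more than \<open>s\<close> indices can be selected. This is how the scan selector treats
  ties.\<close>

definition top_indices :: "('i \<Rightarrow> 'b::linorder) \<Rightarrow> 'i set \<Rightarrow> nat \<Rightarrow> 'i set" where
  "top_indices v I s = {i \<in> I. card {j \<in> I. v i < v j} < s}"

lemma top_indices_subset: "top_indices v I s \<subseteq> I"
  by (auto simp: top_indices_def)

text \<open>Without ties, the ranks are distinct numbers below \<open>card I\<close> and hence
  exhaust them; the top indices are those of rank below \<open>s\<close>.\<close>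

lemma card_top_indices:
  fixes v :: "'i \<Rightarrow> 'b::linorder"
  assumes I: "finite I" and v: "inj_on v I" and s: "s \<le> card I"
  shows "card (top_indices v I s) = s"
proof -
  define r where "r i = card {j \<in> I. v i < v j}" for i
  have r_less: "r i < r k" if "i \<in> I" "k \<in> I" "v k < v i" for i k
    unfolding r_def using I that by (intro psubset_card_mono) auto
  have inj: "inj_on r I"
  proof (rule inj_onI)
    fix i k assume ik: "i \<in> I" "k \<in> I" "r i = r k"
    then have "v i = v k" using r_less[of i k] r_less[of k i] by force
    then show "i = k" using v ik by (auto dest: inj_onD)
  qed
  have "r ` I \<subseteq> {..<card I}"
    unfolding r_def using I by (auto intro!: psubset_card_mono)
  then have img: "r ` I = {..<card I}"
    using inj I by (intro card_subset_eq) (auto simp: card_image)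
  have "r ` top_indices v I s = {..<s}"
  proof
    show "r ` top_indices v I s \<subseteq> {..<s}"
      by (auto simp: top_indices_def r_def)
    show "{..<s} \<subseteq> r ` top_indices v I s"
    proof
      fix k assume "k \<in> {..<s}"
      then have "k \<in> r ` I" using img s by auto
      then show "k \<in> r ` top_indices v I s"
        using \<open>k \<in> {..<s}\<close> by (auto simp: top_indices_def r_def)
    qed
  qed
  moreover have "inj_on r (top_indices v I s)"
    using inj top_indices_subset by (rule inj_on_subset)
  ultimately show ?thesis by (metis card_image card_lessThan)
qed

text \<open>Exchange argument: the two differences of \<open>T\<close> and the top set are
  equinumerous, and each value outside the top set is at most each value inside. Nonnegativity
  allows multiplying by the common factors.\<close>

lemma prod_le_prod_top_indices:
  fixes v :: "'i \<Rightarrow> real"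
  assumes I: "finite I" and v: "inj_on v I" and nonneg: "\<And>i. i \<in> I \<Longrightarrow> 0 \<le> v i"
    and T: "T \<subseteq> I" and s: "s \<le> card I" "card T = s"
  shows "prod v T \<le> prod v (top_indices v I s)"
proof -
  let ?S = "top_indices v I s"
  have S: "?S \<subseteq> I" by (rule top_indices_subset)
  have fin: "finite ?S" "finite T"
    using I by (auto intro: finite_subset[OF S] finite_subset[OF T])
  have "card (T - ?S) = card (?S - T)"
    using card_top_indices[OF I v s(1)] s(2) fin
    by (simp add: card_Diff_subset_Int Int_commute[of T])
  then obtain \<phi> where \<phi>: "bij_betw \<phi> (T - ?S) (?S - T)"
    using finite_same_card_bij[of "T - ?S" "?S - T"] fin by auto
  have le: "v i \<le> v j" if "i \<in> I - ?S" "j \<in> ?S" for i j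
  proof (rule ccontr)
    assume "\<not> v i \<le> v j"
    \<comment> \<open>Whatever exceeds \<open>v i\<close> then also exceeds \<open>v j\<close>, so
      \<open>i\<close> would have rank below \<open>s\<close> as well.\<close>
    then have "card {k \<in> I. v i < v k} \<le> card {k \<in> I. v j < v k}"
      using I by (intro card_mono) auto
    then show False using that by (auto simp: top_indices_def)
  qed
  have "prod v (T - ?S) \<le> (\<Prod>i\<in>T - ?S. v (\<phi> i))"
  proof (intro prod_mono conjI)
    fix i assume i: "i \<in> T - ?S"
    then show "0 \<le> v i" using T nonneg by auto
    show "v i \<le> v (\<phi> i)"
      using i T bij_betwE[OF \<phi>] by (intro le) auto
  qed
  also have "\<dots> = prod v (?S - T)"
    using \<phi> by (rule prod.reindex_bij_betw)
  finally have *: "prod v (T - ?S) \<le> prod v (?S - T)" .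
  have "prod v T = prod v (T \<inter> ?S) * prod v (T - ?S)"
    using fin(2) by (rule prod.Int_Diff)
  also have "\<dots> \<le> prod v (T \<inter> ?S) * prod v (?S - T)"
    using * by (rule mult_left_mono) (use T nonneg in \<open>auto intro!: prod_nonneg\<close>)
  also have "\<dots> = prod v ?S"
    using prod.Int_Diff[OF fin(1), of v T] by (simp add: Int_commute)
  finally show ?thesis .
qed

text \<open>A permutation of \<open>I\<close> preserves the counts that define ranks; this is the
  source of the permutation symmetry of the scan selector.\<close>

lemma top_indices_reindex:
  assumes \<pi>: "bij_betw \<pi> I I"
  shows "top_indices (\<lambda>i. v (\<pi> i)) I k = {i \<in> I. \<pi> i \<in> top_indices v I k}"
proof -
  have "card {j \<in> I. v (\<pi> i) < v (\<pi> j)} = card {j \<in> I. v (\<pi> i) < v j}" for i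
  proof (rule bij_betw_same_card)
    show "bij_betw \<pi> {j \<in> I. v (\<pi> i) < v (\<pi> j)} {j \<in> I. v (\<pi> i) < v j}"
      using \<pi> unfolding bij_betw_def by (auto intro: inj_on_subset)
  qed
  then show ?thesis
    using bij_betwE[OF \<pi>] by (auto simp: top_indices_def)
qed

section \<open>Densities of product measures and permutations of a finite set\<close>

text \<open>Both measures agree on boxes: the indicator of a box factorizes, and the integral of a
  product of functions of separate coordinates is the product of the integrals. Sigma-finiteness of
  the factors makes boxes determine the product measure.\<close>

lemma PiM_density:
  assumes "finite I" and M: "\<And>i. sigma_finite_measure (M i)"
    and f [measurable]: "\<And>i. f i \<in> borel_measurable (M i)"
    and D: "\<And>i. sigma_finite_measure (density (M i) (f i))"
  shows "PiM I (\<lambda>i. density (M i) (f i)) = density (PiM I M) (\<lambda>x. \<Prod>i\<in>I. f i (x i))"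
proof -
  interpret M: product_sigma_finite M by (simp add: product_sigma_finite_def M)
  interpret D: product_sigma_finite "\<lambda>i. density (M i) (f i)" by (simp add: product_sigma_finite_def D)
  show ?thesis
  proof (rule D.PiM_eqI[symmetric])
    show "sets (density (PiM I M) (\<lambda>x. \<Prod>i\<in>I. f i (x i))) = sets (PiM I (\<lambda>i. density (M i) (f i)))"
      by (auto intro!: sets_PiM_cong)
    fix A assume "\<And>i. i \<in> I \<Longrightarrow> A i \<in> sets (density (M i) (f i))"
    then have A [measurable]: "\<And>i. i \<in> I \<Longrightarrow> A i \<in> sets (M i)" by simp
    have [measurable]: "Pi\<^sub>E I A \<in> sets (PiM I M)"
      using \<open>finite I\<close> A by (intro sets_PiM_I_finite) auto
    have "emeasure (density (PiM I M) (\<lambda>x. \<Prod>i\<in>I. f i (x i))) (Pi\<^sub>E I A)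
        = (\<integral>\<^sup>+x. (\<Prod>i\<in>I. f i (x i)) * indicator (Pi\<^sub>E I A) x \<partial>PiM I M)"
      by (rule emeasure_density) measurable
    also have "\<dots> = (\<integral>\<^sup>+x. (\<Prod>i\<in>I. f i (x i) * indicator (A i) (x i)) \<partial>PiM I M)"
      using \<open>finite I\<close>
      by (intro nn_integral_cong)
        (auto simp: prod.distrib indicator_def space_PiM PiE_iff prod_zero_iff split: if_splits)
    also have "\<dots> = (\<Prod>i\<in>I. \<integral>\<^sup>+x. f i x * indicator (A i) x \<partial>M i)"
      using \<open>finite I\<close> by (intro M.product_nn_integral_prod) auto
    also have "\<dots> = (\<Prod>i\<in>I. emeasure (density (M i) (f i)) (A i))"
      by (intro prod.cong refl emeasure_density[symmetric]) auto
    finally show "emeasure (density (PiM I M) (\<lambda>x. \<Prod>i\<in>I. f i (x i))) (Pi\<^sub>E I A)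
        = (\<Prod>i\<in>I. emeasure (density (M i) (f i)) (A i))" .
  qed fact
qed

text \<open>A bijection between \<open>A\<close> and \<open>B\<close> is glued to one between the
  complements, which have equal size too. It will carry one support to another.\<close>

lemma ex_bij_betw_subset:
  assumes "finite I" "A \<subseteq> I" "B \<subseteq> I" "card A = card B"
  obtains \<pi> where "bij_betw \<pi> I I" "\<And>i. i \<in> I \<Longrightarrow> \<pi> i \<in> B \<longleftrightarrow> i \<in> A"
proof -
  have fin: "finite A" "finite B" using assms finite_subset by blast+
  obtain p where p: "bij_betw p A B"
    using finite_same_card_bij[OF fin assms(4)] by blast
  obtain q where q: "bij_betw q (I - A) (I - B)"
    using finite_same_card_bij[of "I - A" "I - B"] assms fin by (auto simp: card_Diff_subset)
  let ?\<pi> = "\<lambda>i. if i \<in> A then p i else q i"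
  have "bij_betw ?\<pi> (A \<union> (I - A)) (B \<union> (I - B))"
    by (intro bij_betw_combine bij_betw_cong[THEN iffD1, OF _ p] bij_betw_cong[THEN iffD1, OF _ q]) auto
  moreover have "A \<union> (I - A) = I" "B \<union> (I - B) = I" using assms by auto
  ultimately have "bij_betw ?\<pi> I I" by simp
  moreover have "?\<pi> i \<in> B \<longleftrightarrow> i \<in> A" if "i \<in> I" for i
    using that p q by (auto dest: bij_betwE)
  ultimately show thesis by (rule that)
qed

section \<open>The scan selector in terms of ranks, and supports of binary vectors\<close>

text \<open>The top values are the first \<open>s\<close> entries of the decreasing list, and
  sorting or reversing does not change how many entries exceed a level.\<close>

lemma top_lik_ratios_iff:
  assumes "s \<le> d" "i \<in> {1..d}"
  shows "lik_ratio f0 f1 i \<omega> \<in> top_lik_ratios f0 f1 d s \<omega>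
    \<longleftrightarrow> i \<in> top_indices (\<lambda>i. lik_ratio f0 f1 i \<omega>) {1..d} s"
proof -
  let ?L = "\<lambda>i. lik_ratio f0 f1 i \<omega>"
  let ?xs = "map ?L [1..<Suc d]"
  let ?ys = "rev (sort ?xs)"
  have "top_lik_ratios f0 f1 d s \<omega> = (!) ?ys ` ((\<lambda>k. k - 1) ` {1..s})"
    by (simp add: top_lik_ratios_def ordered_lik_ratio_def image_image)
  also have "{1..s} = Suc ` {0..<s}"
    by (metis One_nat_def atLeastLessThanSuc_atLeastAtMost image_Suc_atLeastLessThan)
  also have "(\<lambda>k. k - 1) ` Suc ` {0..<s} = {0..<s}"
    unfolding image_image by simp
  \<comment> \<open>The positions \<open>0..<s\<close> exist because the list has length
    \<open>d\<close> and \<open>s \<le> d\<close>.\<close>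
  also have "(!) ?ys ` {0..<s} = set (take s ?ys)"
    using assms by (intro nth_image) simp
  finally have top: "?L i \<in> top_lik_ratios f0 f1 d s \<omega>
      \<longleftrightarrow> ?L i \<in> set ?ys \<and> length (filter (\<lambda>y. ?L i < y) ?ys) < s"
    by (simp add: mem_set_take_decreasing sorted_wrt_rev)
  have "i \<in> set [1..<Suc d]" using assms by auto
  then have mem: "?L i \<in> set ?ys" unfolding set_rev set_sort set_map by (rule imageI)
  have "length (filter (\<lambda>y. ?L i < y) ?ys) = length (filter (\<lambda>y. ?L i < y) ?xs)"
    by (metis mset_filter mset_rev mset_sort size_mset)
  also have "\<dots> = length (filter (\<lambda>j. ?L i < ?L j) [1..<Suc d])"
    by (simp only: filter_map length_map o_def)
  also have "\<dots> = card (set (filter (\<lambda>j. ?L i < ?L j) [1..<Suc d]))"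
    by (rule distinct_card[symmetric]) simp
  also have "set (filter (\<lambda>j. ?L i < ?L j) [1..<Suc d]) = {j \<in> {1..d}. ?L i < ?L j}"
    by auto
  finally show ?thesis using top mem assms by (simp add: top_indices_def)
qed

lemma supp_scan_selector:
  assumes "s \<le> d"
  shows "supp d (scan_selector f0 f1 d s \<omega>) = top_indices (\<lambda>i. lik_ratio f0 f1 i \<omega>) {1..d} s"
proof -
  have "supp d (scan_selector f0 f1 d s \<omega>)
      = {i \<in> {1..d}. lik_ratio f0 f1 i \<omega> \<in> top_lik_ratios f0 f1 d s \<omega>}"
    by (auto simp: supp_def scan_selector_def)
  also have "\<dots> = top_indices (\<lambda>i. lik_ratio f0 f1 i \<omega>) {1..d} s"
    using top_lik_ratios_iff[OF assms] top_indices_subset by fast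
  finally show ?thesis .
qed

lemma supp_eq_iff: "supp d \<eta> = supp d \<eta>' \<longleftrightarrow> (\<forall>i\<in>{1..d}. i \<in> supp d \<eta> \<longleftrightarrow> i \<in> supp d \<eta>')"
  unfolding supp_def set_eq_iff by blast

text \<open>An entry in \<open>{0, 1}\<close> is determined by whether it vanishes, and
  extensionality fixes the rest; thus recovering the support is recovering the vector.\<close>

lemma supp_inj:
  assumes "\<eta> \<in> binary_vectors d" "\<eta>' \<in> binary_vectors d" "supp d \<eta> = supp d \<eta>'"
  shows "\<eta> = \<eta>'"
proof (rule PiE_ext)
  show "\<eta> \<in> {1..d} \<rightarrow>\<^sub>E {0, 1}" "\<eta>' \<in> {1..d} \<rightarrow>\<^sub>E {0, 1}"
    using assms by (simp_all add: binary_vectors_def)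
  fix i assume i: "i \<in> {1..d}"
  then have "\<eta> i \<in> {0, 1}" "\<eta>' i \<in> {0, 1}"
    using assms unfolding binary_vectors_def by blast+
  moreover have "\<eta> i \<noteq> 0 \<longleftrightarrow> \<eta>' i \<noteq> 0"
    using assms(3) i by (auto simp: supp_def)
  ultimately show "\<eta> i = \<eta>' i" by auto
qed

lemma binary_vectors_eq_1_iff:
  assumes "\<eta> \<in> binary_vectors d" "i \<in> {1..d}"
  shows "\<eta> i = 1 \<longleftrightarrow> i \<in> supp d \<eta>"
proof -
  have "\<eta> i \<in> {0, 1}"
    using assms unfolding binary_vectors_def by (rule PiE_mem)
  then show ?thesis using assms by (auto simp: supp_def)
qed

lemma finite_binary_vectors [simp]: "finite (binary_vectors d)"
  unfolding binary_vectors_def by (intro finite_PiE) auto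

lemma sparse_vectors_subset: "sparse_vectors d s \<subseteq> binary_vectors d"
  by (auto simp: sparse_vectors_def)

lemma finite_sparse_vectors [simp]: "finite (sparse_vectors d s)"
  using sparse_vectors_subset by (rule finite_subset) simp

lemma supp_first_ones: "s \<le> d \<Longrightarrow> supp d (first_ones d s) = {1..s}"
  by (auto simp: supp_def first_ones_def)

lemma first_ones_sparse: "s \<le> d \<Longrightarrow> first_ones d s \<in> sparse_vectors d s"
  unfolding sparse_vectors_def by (auto simp: supp_first_ones) (auto simp: binary_vectors_def first_ones_def)

lemma scan_selector_binary: "scan_selector f0 f1 d s \<omega> \<in> binary_vectors d"
  by (auto simp: binary_vectors_def scan_selector_def)

section \<open>Marginals and coordinate permutations of product laws\<close>

text \<open>Projecting away \<open>Z\<close> and then onto one coordinate transfers almost sure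
  statements about the sample to the law of a single observation.\<close>

lemma distr_pair_fst_coordinate:
  assumes M: "\<And>i. i \<in> I \<Longrightarrow> prob_space (M i)" and Z: "prob_space Z" and i: "i \<in> I"
  shows "distr (PiM I M \<Otimes>\<^sub>M Z) (M i) (\<lambda>\<omega>. fst \<omega> i) = M i"
proof -
  have "distr (PiM I M \<Otimes>\<^sub>M Z) (M i) (\<lambda>\<omega>. fst \<omega> i)
      = distr (distr (PiM I M \<Otimes>\<^sub>M Z) (PiM I M) fst) (M i) (\<lambda>x. x i)"
    using i by (subst distr_distr) (auto simp: o_def)
  also have "distr (PiM I M \<Otimes>\<^sub>M Z) (PiM I M) fst = PiM I M"
    by (rule prob_space.distr_pair_fst[OF Z])
  also have "distr (PiM I M) (M i) (\<lambda>x. x i) = M i"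
    using M i by (rule distr_PiM_component)
  finally show ?thesis .
qed

text \<open>Permuting the observations permutes their marginals. The fixed factor \<open>Z\<close>
  is written as its push-forward under the identity, so that the rule for pairs applies.\<close>

lemma distr_pair_reindex:
  assumes M: "\<And>i. i \<in> I \<Longrightarrow> prob_space (M i)" and Z: "prob_space Z" and \<pi>: "bij_betw \<pi> I I"
  shows "distr (PiM I M \<Otimes>\<^sub>M Z) (PiM I (\<lambda>i. M (\<pi> i)) \<Otimes>\<^sub>M Z)
      (\<lambda>\<omega>. (\<lambda>n\<in>I. fst \<omega> (\<pi> n), snd \<omega>)) = PiM I (\<lambda>i. M (\<pi> i)) \<Otimes>\<^sub>M Z"
proof -
  let ?t = "\<lambda>x. \<lambda>n\<in>I. x (\<pi> n)"
  have \<pi>I: "\<pi> i \<in> I" if "i \<in> I" for i using bij_betwE[OF \<pi>] that by blast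
  have [measurable]: "?t \<in> PiM I M \<rightarrow>\<^sub>M PiM I (\<lambda>i. M (\<pi> i))"
    using \<pi>I by (intro measurable_restrict measurable_component_singleton)
  have d: "distr (PiM I M) (PiM I (\<lambda>i. M (\<pi> i))) ?t = PiM I (\<lambda>i. M (\<pi> i))"
    using M \<pi> \<pi>I by (intro distr_PiM_reindex) (auto simp: bij_betw_def)
  have "distr (PiM I M) (PiM I (\<lambda>i. M (\<pi> i))) ?t \<Otimes>\<^sub>M distr Z Z (\<lambda>z. z)
      = distr (PiM I M \<Otimes>\<^sub>M Z) (PiM I (\<lambda>i. M (\<pi> i)) \<Otimes>\<^sub>M Z) (\<lambda>(x, z). (?t x, z))"
    using Z by (intro pair_measure_distr) (auto simp: prob_space_imp_sigma_finite)
  then show ?thesis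
    by (simp add: d case_prod_beta')
qed

section \<open>The selection model and its likelihood ratios\<close>

locale selection_model =
  fixes d s :: nat and \<mu> P0 P1 :: "'a measure" and f0 f1 :: "'a \<Rightarrow> real" and Z :: "'z measure"
  assumes s: "1 \<le> s" "s < d"
    and P0: "prob_space P0" and P1: "prob_space P1" and Z: "prob_space Z"
    and f0 [measurable]: "f0 \<in> borel_measurable \<mu>" and f0_nonneg: "\<And>x. x \<in> space \<mu> \<Longrightarrow> 0 \<le> f0 x"
    and P0_eq: "P0 = density \<mu> (\<lambda>x. ennreal (f0 x))"
    and f1 [measurable]: "f1 \<in> borel_measurable \<mu>" and f1_nonneg: "\<And>x. x \<in> space \<mu> \<Longrightarrow> 0 \<le> f1 x"
    and P1_eq: "P1 = density \<mu> (\<lambda>x. ennreal (f1 x))"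
    and lik_ratio_well_defined:
      "\<And>\<eta>. \<eta> \<in> binary_vectors d \<Longrightarrow>
         AE \<omega> in obs_law P0 P1 Z d \<eta>. \<forall>i\<in>{1..d}. f0 (fst \<omega> i) \<noteq> 0"
    and no_ties:
      "\<And>\<eta>. \<eta> \<in> sparse_vectors d s \<Longrightarrow>
         \<P>(\<omega> in obs_law P0 P1 Z d \<eta>.
            \<forall>i\<in>{1..d}. \<forall>j\<in>{1..d}. i \<noteq> j \<longrightarrow> lik_ratio f0 f1 i \<omega> \<noteq> lik_ratio f0 f1 j \<omega>) = 1"
begin

abbreviation "obs \<equiv> obs_law P0 P1 Z d"
abbreviation "err \<equiv> error_prob P0 P1 Z d"
abbreviation "scan \<equiv> scan_selector f0 f1 d s"
abbreviation "ratios \<omega> \<equiv> \<lambda>i. lik_ratio f0 f1 i \<omega>"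
abbreviation "sample_space \<equiv> (\<Pi>\<^sub>M j\<in>{1..d}. \<mu>) \<Otimes>\<^sub>M Z"

text \<open>The law under \<open>\<eta> = 0\<close>, serving as a common dominating measure for all
  \<open>obs \<eta>\<close>.\<close>

definition null_law :: "((nat \<Rightarrow> 'a) \<times> 'z) measure" where
  "null_law = (\<Pi>\<^sub>M j\<in>{1..d}. P0) \<Otimes>\<^sub>M Z"

text \<open>The likelihood ratio of \<open>obs \<eta>\<close> against \<open>null_law\<close>. The
  product runs over all coordinates, with factor 1 off the support, to match the density of a
  product measure.\<close>

definition joint_ratio :: "(nat \<Rightarrow> nat) \<Rightarrow> (nat \<Rightarrow> 'a) \<times> 'z \<Rightarrow> ennreal" where
  "joint_ratio \<eta> \<omega> = (\<Prod>i\<in>{1..d}. if \<eta> i = 1 then ennreal (f1 (fst \<omega> i) / f0 (fst \<omega> i)) else 1)"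

lemma sets_P0 [measurable_cong, simp]: "sets P0 = sets \<mu>"
  by (simp add: P0_eq)

lemma sets_P1 [measurable_cong, simp]: "sets P1 = sets \<mu>"
  by (simp add: P1_eq)

lemma space_P1 [simp]: "space P1 = space \<mu>"
  by (simp add: P1_eq)

lemma prob_space_mixed: "prob_space (if b then P1 else P0)"
  using P0 P1 by simp

lemma sets_obs [measurable_cong, simp]: "sets (obs \<eta>) = sets sample_space"
  unfolding obs_law_def by (intro sets_pair_measure_cong sets_PiM_cong) auto

lemma space_obs [simp]: "space (obs \<eta>) = space sample_space"
  by (rule sets_eq_imp_space_eq) (rule sets_obs)

lemma sets_null_law [measurable_cong, simp]: "sets null_law = sets sample_space"
  unfolding null_law_def by (intro sets_pair_measure_cong sets_PiM_cong) auto

lemma space_null_law [simp]: "space null_law = space sample_space"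
  by (rule sets_eq_imp_space_eq) (rule sets_null_law)

lemma prob_space_obs: "prob_space (obs \<eta>)"
  unfolding obs_law_def
  by (intro prob_space_pair prob_space_PiM prob_space_mixed Z)

lemma lik_ratio_measurable:
  "i \<in> {1..d} \<Longrightarrow> lik_ratio f0 f1 i \<in> borel_measurable sample_space"
  unfolding lik_ratio_def by measurable

lemma lik_ratio_nonneg:
  "\<omega> \<in> space sample_space \<Longrightarrow> i \<in> {1..d} \<Longrightarrow> 0 \<le> lik_ratio f0 f1 i \<omega>"
  unfolding lik_ratio_def
  by (intro divide_nonneg_nonneg f0_nonneg f1_nonneg) (auto simp: space_pair_measure space_PiM)

text \<open>Absolute continuity of \<open>P1\<close> with respect to \<open>P0\<close> is hidden in
  \<open>lik_ratio_well_defined\<close>: for the all-ones vector the first observation has law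
  \<open>P1\<close>, so \<open>f0\<close> is nonzero almost surely under \<open>P1\<close>.\<close>

lemma P1_eq_density_P0: "P1 = density P0 (\<lambda>x. ennreal (f1 x / f0 x))"
proof -
  let ?\<eta> = "\<lambda>i\<in>{1..d}. 1"
  have obs1: "obs ?\<eta> = PiM {1..d} (\<lambda>_. P1) \<Otimes>\<^sub>M Z"
    unfolding obs_law_def by (intro arg_cong2[where f = pair_measure] PiM_cong) auto
  have "AE \<omega> in obs ?\<eta>. \<forall>i\<in>{1..d}. f0 (fst \<omega> i) \<noteq> 0"
    by (rule lik_ratio_well_defined) (auto simp: binary_vectors_def)
  then have "AE \<omega> in PiM {1..d} (\<lambda>_. P1) \<Otimes>\<^sub>M Z. f0 (fst \<omega> 1) \<noteq> 0"
    unfolding obs1 by eventually_elim (use s in auto)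
  then have "AE x in distr (PiM {1..d} (\<lambda>_. P1) \<Otimes>\<^sub>M Z) P1 (\<lambda>\<omega>. fst \<omega> 1). f0 x \<noteq> 0"
    using s by (subst AE_distr_iff) auto
  then have "AE x in P1. f0 x \<noteq> 0"
    using s by (subst (asm) distr_pair_fst_coordinate) (auto simp: P1 Z)
  then have "AE x in \<mu>. 0 < f1 x \<longrightarrow> f0 x \<noteq> 0"
    unfolding P1_eq by (subst (asm) AE_density) auto
  then have "AE x in \<mu>. ennreal (f1 x) = ennreal (f0 x) * ennreal (f1 x / f0 x)"
    using AE_space
  proof eventually_elim
    case (elim x)
    \<comment> \<open>If \<open>f0 x = 0\<close>, then \<open>f1 x = 0\<close> as well, and the
      default value of the quotient does no harm.\<close>
    then show ?case using f0_nonneg[of x] f1_nonneg[of x]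
      by (cases "f0 x = 0") (auto simp: ennreal_mult'[symmetric] order.order_iff_strict)
  qed
  then have "P1 = density \<mu> (\<lambda>x. ennreal (f0 x) * ennreal (f1 x / f0 x))"
    unfolding P1_eq by (intro density_cong) auto
  also have "\<dots> = density P0 (\<lambda>x. ennreal (f1 x / f0 x))"
    unfolding P0_eq by (rule density_density_eq[symmetric]) auto
  finally show ?thesis .
qed

lemma joint_ratio_measurable [measurable]: "joint_ratio \<eta> \<in> borel_measurable sample_space"
  unfolding joint_ratio_def by measurable

lemma joint_ratio_measurable_null_law [simp]: "joint_ratio \<eta> \<in> borel_measurable null_law"
  by measurable

lemma obs_eq_density: "obs \<eta> = density null_law (joint_ratio \<eta>)"
proof -
  let ?g = "\<lambda>i x. if \<eta> i = 1 then ennreal (f1 x / f0 x) else 1"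
  have mixed: "(if \<eta> i = 1 then P1 else P0) = density P0 (?g i)" for i
    using P1_eq_density_P0 density_1[of P0] by simp
  have "obs \<eta> = (\<Pi>\<^sub>M i\<in>{1..d}. density P0 (?g i)) \<Otimes>\<^sub>M Z"
    unfolding obs_law_def mixed ..
  also have "(\<Pi>\<^sub>M i\<in>{1..d}. density P0 (?g i))
      = density (\<Pi>\<^sub>M i\<in>{1..d}. P0) (\<lambda>x. \<Prod>i\<in>{1..d}. ?g i (x i))"
  proof (rule PiM_density)
    show "sigma_finite_measure (density P0 (?g i))" for i
      unfolding mixed[symmetric] by (rule prob_space_imp_sigma_finite) (rule prob_space_mixed)
  qed (auto intro: prob_space_imp_sigma_finite P0)
  \<comment> \<open>The constant density 1 on \<open>Z\<close> puts both factors in the form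
    required by the product rule for densities.\<close>
  also have "\<dots> \<Otimes>\<^sub>M Z = \<dots> \<Otimes>\<^sub>M density Z (\<lambda>_. 1)"
    by (simp add: density_1)
  also have "\<dots> = density null_law (\<lambda>(x, z). (\<Prod>i\<in>{1..d}. ?g i (x i)) * 1)"
    unfolding null_law_def using Z by (intro pair_measure_density) (auto simp: density_1 prob_space_imp_sigma_finite)
  also have "(\<lambda>(x, z). (\<Prod>i\<in>{1..d}. ?g i (x i)) * 1) = joint_ratio \<eta>"
    by (auto simp: joint_ratio_def fun_eq_iff intro!: prod.cong)
  finally show ?thesis .
qed

lemma joint_ratio_eq_prod:
  assumes "\<eta> \<in> binary_vectors d" "\<omega> \<in> space sample_space"
  shows "joint_ratio \<eta> \<omega> = ennreal (prod (ratios \<omega>) (supp d \<eta>))"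
proof -
  have "joint_ratio \<eta> \<omega> = (\<Prod>i\<in>{1..d}. if \<eta> i = 1 then ennreal (ratios \<omega> i) else 1)"
    unfolding joint_ratio_def lik_ratio_def ..
  also have "\<dots> = (\<Prod>i\<in>{i \<in> {1..d}. \<eta> i = 1}. ennreal (ratios \<omega> i))"
    by (rule prod.inter_filter[symmetric]) simp
  also have "{i \<in> {1..d}. \<eta> i = 1} = supp d \<eta>"
    using binary_vectors_eq_1_iff[OF assms(1)] by (auto simp: supp_def)
  also have "(\<Prod>i\<in>supp d \<eta>. ennreal (ratios \<omega> i)) = ennreal (prod (ratios \<omega>) (supp d \<eta>))"
    using assms(2) by (intro prod_ennreal lik_ratio_nonneg) (auto simp: supp_def)
  finally show ?thesis .
qed

section \<open>Measurability of the scan selector and absence of ties\<close>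

lemma supp_scan: "supp d (scan \<omega>) = top_indices (ratios \<omega>) {1..d} s"
  using s by (intro supp_scan_selector) simp

lemma scan_sparse:
  assumes "inj_on (ratios \<omega>) {1..d}"
  shows "scan \<omega> \<in> sparse_vectors d s"
  using card_top_indices[OF _ assms] s
  by (simp add: sparse_vectors_def supp_scan scan_selector_binary)

text \<open>A rank is a finite sum of indicators of measurable comparisons, and each value of the
  scan selector is described by finitely many rank events; as there are finitely many values, this
  gives measurability.\<close>

lemma scan_in_selectors: "scan \<in> selectors \<mu> Z d"
proof -
  have top: "{\<omega> \<in> space sample_space. i \<in> top_indices (ratios \<omega>) {1..d} s} \<in> sets sample_space"
    if i: "i \<in> {1..d}" for i
  proof -
    note [measurable] = lik_ratio_measurable lik_ratio_measurable[OF i]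
    have "i \<in> top_indices (ratios \<omega>) {1..d} s
        \<longleftrightarrow> (\<Sum>j\<in>{1..d}. if ratios \<omega> i < ratios \<omega> j then 1 else 0 :: real) < real s"
      for \<omega> :: "(nat \<Rightarrow> 'a) \<times> 'z"
      using i by (simp add: top_indices_def flip: sum.inter_filter)
    moreover have "{\<omega> \<in> space sample_space.
        (\<Sum>j\<in>{1..d}. if ratios \<omega> i < ratios \<omega> j then 1 else 0 :: real) < real s} \<in> sets sample_space"
      by measurable
    ultimately show ?thesis by (simp only:)
  qed
  have "scan -` {\<eta>} \<inter> space sample_space \<in> sets sample_space" if \<eta>: "\<eta> \<in> binary_vectors d" for \<eta>
  proof -
    have "scan \<omega> = \<eta> \<longleftrightarrow> (\<forall>i\<in>{1..d}. i \<in> top_indices (ratios \<omega>) {1..d} s \<longleftrightarrow> i \<in> supp d \<eta>)"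
      for \<omega> :: "(nat \<Rightarrow> 'a) \<times> 'z"
    proof -
      have "scan \<omega> = \<eta> \<longleftrightarrow> supp d (scan \<omega>) = supp d \<eta>"
        using supp_inj[OF scan_selector_binary \<eta>] by metis
      also have "\<dots> \<longleftrightarrow> (\<forall>i\<in>{1..d}. i \<in> top_indices (ratios \<omega>) {1..d} s \<longleftrightarrow> i \<in> supp d \<eta>)"
        unfolding supp_scan[symmetric] by (rule supp_eq_iff)
      finally show ?thesis .
    qed
    then have "scan -` {\<eta>} \<inter> space sample_space
        = {\<omega> \<in> space sample_space. \<forall>i\<in>{1..d}. i \<in> top_indices (ratios \<omega>) {1..d} s \<longleftrightarrow> i \<in> supp d \<eta>}"
      by auto
    also have "\<dots> \<in> sets sample_space"
      using top by (intro sets.sets_Collect_finite_All) (auto intro: sets.sets_Collect)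
    finally show ?thesis .
  qed
  then show ?thesis
    by (simp add: selectors_def measurable_count_space_eq2 scan_selector_binary)
qed

lemma AE_no_ties:
  assumes "\<eta> \<in> sparse_vectors d s"
  shows "AE \<omega> in obs \<eta>. inj_on (ratios \<omega>) {1..d}"
  using prob_space.AE_prob_1[OF prob_space_obs no_ties[OF assms]]
  by eventually_elim (auto simp: inj_on_def)

lemma selector_measurable:
  assumes "h \<in> selectors \<mu> Z d"
  shows "{\<omega> \<in> space sample_space. P (h \<omega>)} \<in> sets sample_space"
proof -
  have h: "h \<in> sample_space \<rightarrow>\<^sub>M count_space (binary_vectors d)"
    using assms by (simp add: selectors_def)
  have "h -` {\<eta> \<in> binary_vectors d. P \<eta>} \<inter> space sample_space \<in> sets sample_space"
    by (rule measurable_sets[OF h]) auto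
  also have "h -` {\<eta> \<in> binary_vectors d. P \<eta>} \<inter> space sample_space = {\<omega> \<in> space sample_space. P (h \<omega>)}"
    using measurable_space[OF h] by auto
  finally show ?thesis .
qed

lemma selector_binary:
  "h \<in> selectors \<mu> Z d \<Longrightarrow> \<omega> \<in> space sample_space \<Longrightarrow> h \<omega> \<in> binary_vectors d"
  unfolding selectors_def by (drule measurable_space) auto

section \<open>Bayes optimality of the scan selector under the uniform prior\<close>

text \<open>Recovery is expressed by equality of vectors, so that for fixed \<open>\<omega>\<close>
  at most one \<open>\<eta>\<close> is hit.\<close>

definition hit_prob :: "((nat \<Rightarrow> 'a) \<times> 'z \<Rightarrow> nat \<Rightarrow> nat) \<Rightarrow> (nat \<Rightarrow> nat) \<Rightarrow> real" where
  "hit_prob h \<eta> = \<P>(\<omega> in obs \<eta>. h \<omega> = \<eta>)"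

lemma error_prob_eq:
  assumes h: "h \<in> selectors \<mu> Z d" and \<eta>: "\<eta> \<in> binary_vectors d"
  shows "err h \<eta> = 1 - hit_prob h \<eta>"
proof -
  interpret prob_space "obs \<eta>" by (rule prob_space_obs)
  have "err h \<eta> = \<P>(\<omega> in obs \<eta>. \<not> h \<omega> = \<eta>)"
    unfolding error_prob_def
    using supp_inj[OF selector_binary[OF h] \<eta>] by (intro arg_cong2[where f = measure]) auto
  also have "\<dots> = 1 - hit_prob h \<eta>"
    unfolding hit_prob_def using selector_measurable[OF h] by (intro prob_neg) simp
  finally show ?thesis .
qed

text \<open>Each probability is the integral of a density over an event; after interchanging sum and
  integral, only the term with \<open>\<eta> = h \<omega>\<close> survives, and only if
  \<open>h \<omega>\<close> is sparse.\<close>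

lemma sum_hit_prob:
  assumes h: "h \<in> selectors \<mu> Z d"
  shows "ennreal (\<Sum>\<eta>\<in>sparse_vectors d s. hit_prob h \<eta>)
    = (\<integral>\<^sup>+\<omega>. (if h \<omega> \<in> sparse_vectors d s then joint_ratio (h \<omega>) \<omega> else 0) \<partial>null_law)"
proof -
  have "ennreal (hit_prob h \<eta>)
      = (\<integral>\<^sup>+\<omega>. joint_ratio \<eta> \<omega> * indicator {\<omega> \<in> space sample_space. h \<omega> = \<eta>} \<omega> \<partial>null_law)" for \<eta>
  proof -
    interpret prob_space "obs \<eta>" by (rule prob_space_obs)
    have "ennreal (hit_prob h \<eta>) = emeasure (obs \<eta>) {\<omega> \<in> space sample_space. h \<omega> = \<eta>}"
      by (simp add: hit_prob_def emeasure_eq_measure)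
    then show ?thesis
      unfolding obs_eq_density using selector_measurable[OF h] by (simp add: emeasure_density)
  qed
  then have "ennreal (\<Sum>\<eta>\<in>sparse_vectors d s. hit_prob h \<eta>)
      = (\<Sum>\<eta>\<in>sparse_vectors d s.
          \<integral>\<^sup>+\<omega>. joint_ratio \<eta> \<omega> * indicator {\<omega> \<in> space sample_space. h \<omega> = \<eta>} \<omega> \<partial>null_law)"
    by (simp add: hit_prob_def flip: sum_ennreal)
  also have "\<dots> = (\<integral>\<^sup>+\<omega>. (\<Sum>\<eta>\<in>sparse_vectors d s.
      joint_ratio \<eta> \<omega> * indicator {\<omega> \<in> space sample_space. h \<omega> = \<eta>} \<omega>) \<partial>null_law)"
    using selector_measurable[OF h]
    by (intro nn_integral_sum[symmetric] borel_measurable_times_ennreal borel_measurable_indicator) simp_all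
  also have "\<dots> = (\<integral>\<^sup>+\<omega>. (if h \<omega> \<in> sparse_vectors d s then joint_ratio (h \<omega>) \<omega> else 0) \<partial>null_law)"
  proof (rule nn_integral_cong)
    fix \<omega> assume "\<omega> \<in> space null_law"
    then have "(\<Sum>\<eta>\<in>sparse_vectors d s. joint_ratio \<eta> \<omega> * indicator {\<omega> \<in> space sample_space. h \<omega> = \<eta>} \<omega>)
        = (\<Sum>\<eta>\<in>sparse_vectors d s. if h \<omega> = \<eta> then joint_ratio \<eta> \<omega> else 0)"
      by (intro sum.cong) auto
    then show "(\<Sum>\<eta>\<in>sparse_vectors d s. joint_ratio \<eta> \<omega> * indicator {\<omega> \<in> space sample_space. h \<omega> = \<eta>} \<omega>)
        = (if h \<omega> \<in> sparse_vectors d s then joint_ratio (h \<omega>) \<omega> else 0)"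
      by simp
  qed
  finally show ?thesis .
qed

text \<open>The integrands of \<open>sum_hit_prob\<close> are compared pointwise: a selection that
  is not \<open>s\<close>-sparse contributes 0, and in the absence of ties the top indices have the
  largest product among sets of size \<open>s\<close>.\<close>

lemma sum_hit_prob_le_scan:
  assumes h: "h \<in> selectors \<mu> Z d"
  shows "(\<Sum>\<eta>\<in>sparse_vectors d s. hit_prob h \<eta>) \<le> (\<Sum>\<eta>\<in>sparse_vectors d s. hit_prob scan \<eta>)"
proof -
  \<comment> \<open>Ties are excluded under the sparse laws, which under \<open>null_law\<close>
    says something only where a joint ratio is positive.\<close>
  have "AE \<omega> in null_law. 0 < joint_ratio \<eta> \<omega> \<longrightarrow> inj_on (ratios \<omega>) {1..d}"
    if "\<eta> \<in> sparse_vectors d s" for \<eta>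
    using AE_no_ties[OF that] unfolding obs_eq_density by (subst (asm) AE_density) simp_all
  then have "AE \<omega> in null_law. \<forall>\<eta>\<in>sparse_vectors d s. 0 < joint_ratio \<eta> \<omega> \<longrightarrow> inj_on (ratios \<omega>) {1..d}"
    by (intro AE_finite_allI) auto
  then have "AE \<omega> in null_law. (if h \<omega> \<in> sparse_vectors d s then joint_ratio (h \<omega>) \<omega> else 0)
      \<le> (if scan \<omega> \<in> sparse_vectors d s then joint_ratio (scan \<omega>) \<omega> else 0)"
    using AE_space
  proof eventually_elim
    case (elim \<omega>)
    then have \<omega>: "\<omega> \<in> space sample_space" by simp
    show ?case
    \<comment> \<open>Outside this case the left side vanishes; inside it, positivity of the joint
      ratio rules out ties.\<close>
    proof (cases "h \<omega> \<in> sparse_vectors d s \<and> 0 < joint_ratio (h \<omega>) \<omega>")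
      case True
      then have inj: "inj_on (ratios \<omega>) {1..d}" using elim by auto
      have "prod (ratios \<omega>) (supp d (h \<omega>)) \<le> prod (ratios \<omega>) (supp d (scan \<omega>))"
        unfolding supp_scan using True s inj lik_ratio_nonneg[OF \<omega>]
        by (intro prod_le_prod_top_indices) (auto simp: sparse_vectors_def supp_def)
      then have "joint_ratio (h \<omega>) \<omega> \<le> joint_ratio (scan \<omega>) \<omega>"
        unfolding joint_ratio_eq_prod[OF selector_binary[OF h \<omega>] \<omega>]
          joint_ratio_eq_prod[OF scan_selector_binary \<omega>] by (rule ennreal_leI)
      then show ?thesis using True scan_sparse[OF inj] by simp
    qed (auto simp: zero_less_iff_neq_zero)
  qed
  then have "ennreal (\<Sum>\<eta>\<in>sparse_vectors d s. hit_prob h \<eta>)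
      \<le> ennreal (\<Sum>\<eta>\<in>sparse_vectors d s. hit_prob scan \<eta>)"
    unfolding sum_hit_prob[OF h] sum_hit_prob[OF scan_in_selectors] by (rule nn_integral_mono_AE)
  then show ?thesis
    by (subst (asm) ennreal_le_iff) (auto simp: hit_prob_def intro!: sum_nonneg)
qed

lemma sum_error_prob_scan_le:
  assumes "h \<in> selectors \<mu> Z d"
  shows "(\<Sum>\<eta>\<in>sparse_vectors d s. err scan \<eta>) \<le> (\<Sum>\<eta>\<in>sparse_vectors d s. err h \<eta>)"
proof -
  have "(\<Sum>\<eta>\<in>sparse_vectors d s. err g \<eta>)
      = real (card (sparse_vectors d s)) - (\<Sum>\<eta>\<in>sparse_vectors d s. hit_prob g \<eta>)"
    if "g \<in> selectors \<mu> Z d" for g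
  proof -
    have "(\<Sum>\<eta>\<in>sparse_vectors d s. err g \<eta>) = (\<Sum>\<eta>\<in>sparse_vectors d s. 1 - hit_prob g \<eta>)"
      using sparse_vectors_subset by (intro sum.cong error_prob_eq[OF that]) auto
    then show ?thesis by (simp add: sum_subtractf)
  qed
  then show ?thesis
    using assms scan_in_selectors sum_hit_prob_le_scan[OF assms] by simp
qed

section \<open>Permutation symmetry and the error event of the scan selector\<close>

text \<open>A permutation of the observations turns the law under \<open>\<eta>\<close> into the law
  under \<open>first_ones d s\<close>, and the scan selector commutes with it, so the error events
  correspond.\<close>

lemma error_prob_scan_eq:
  assumes \<eta>: "\<eta> \<in> sparse_vectors d s"
  shows "err scan \<eta> = err scan (first_ones d s)"
proof -
  let ?e = "first_ones d s"
  have se: "supp d ?e = {1..s}" using s by (simp add: supp_first_ones)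
  \<comment> \<open>\<open>T\<close> will put observation \<open>\<pi> n\<close> in position
    \<open>n\<close>, so \<open>\<pi>\<close> must send the support of \<open>?e\<close> to that of
    \<open>\<eta>\<close>.\<close>
  obtain \<pi> where \<pi>: "bij_betw \<pi> {1..d} {1..d}"
    and \<pi>_supp: "\<And>i. i \<in> {1..d} \<Longrightarrow> \<pi> i \<in> supp d \<eta> \<longleftrightarrow> i \<in> supp d ?e"
    by (rule ex_bij_betw_subset[of "{1..d}" "supp d ?e" "supp d \<eta>"])
      (use \<eta> se s in \<open>auto simp: sparse_vectors_def supp_def\<close>)
  have \<pi>I: "\<pi> i \<in> {1..d}" if "i \<in> {1..d}" for i using bij_betwE[OF \<pi>] that by blast
  define M where "M i = (if \<eta> i = 1 then P1 else P0)" for i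
  define T :: "(nat \<Rightarrow> 'a) \<times> 'z \<Rightarrow> _" where "T \<omega> = (\<lambda>n\<in>{1..d}. fst \<omega> (\<pi> n), snd \<omega>)" for \<omega>
  have one_iff: "\<zeta> i = 1 \<longleftrightarrow> i \<in> supp d \<zeta>" if "\<zeta> \<in> sparse_vectors d s" "i \<in> {1..d}" for \<zeta> i
    using that by (intro binary_vectors_eq_1_iff) (auto simp: sparse_vectors_def)
  have obs_\<eta>: "obs \<eta> = PiM {1..d} M \<Otimes>\<^sub>M Z"
    by (simp add: obs_law_def M_def[abs_def])
  have obs_e: "obs ?e = PiM {1..d} (\<lambda>i. M (\<pi> i)) \<Otimes>\<^sub>M Z"
  proof -
    have "\<eta> (\<pi> i) = 1 \<longleftrightarrow> ?e i = 1" if "i \<in> {1..d}" for i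
      using one_iff[OF \<eta> \<pi>I[OF that]] one_iff[OF first_ones_sparse that] \<pi>_supp[OF that] s by simp
    then show ?thesis
      unfolding obs_law_def M_def by (intro arg_cong2[where f = pair_measure] PiM_cong refl) simp
  qed
  have distr: "distr (obs \<eta>) (obs ?e) T = obs ?e"
    unfolding obs_\<eta> obs_e T_def
    by (rule distr_pair_reindex[OF _ Z \<pi>]) (auto simp: M_def P0 P1)
  have T_meas: "T \<in> obs \<eta> \<rightarrow>\<^sub>M obs ?e"
    unfolding obs_\<eta> obs_e T_def
    by (intro measurable_Pair measurable_snd measurable_restrict
        measurable_compose[OF measurable_fst measurable_component_singleton] \<pi>I)
  have scan_T: "supp d (scan (T \<omega>)) = supp d ?e \<longleftrightarrow> supp d (scan \<omega>) = supp d \<eta>" for \<omega>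
  proof -
    \<comment> \<open>The first component of \<open>T \<omega>\<close> is restricted to
      \<open>{1..d}\<close>, so the ratios are known to be permuted only at these indices, the only
      ones that \<open>top_indices\<close> inspects.\<close>
    have "top_indices (ratios (T \<omega>)) {1..d} s = top_indices (\<lambda>i. ratios \<omega> (\<pi> i)) {1..d} s"
      by (simp add: top_indices_def lik_ratio_def T_def cong: conj_cong)
    then have *: "supp d (scan (T \<omega>)) = {i \<in> {1..d}. \<pi> i \<in> supp d (scan \<omega>)}"
      unfolding supp_scan using top_indices_reindex[OF \<pi>, of "ratios \<omega>"] by simp
    have "supp d (scan (T \<omega>)) = supp d ?e
        \<longleftrightarrow> (\<forall>i\<in>{1..d}. \<pi> i \<in> supp d (scan \<omega>) \<longleftrightarrow> i \<in> supp d ?e)"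
      unfolding * se set_eq_iff using s by fastforce
    also have "\<dots> \<longleftrightarrow> (\<forall>i\<in>{1..d}. \<pi> i \<in> supp d (scan \<omega>) \<longleftrightarrow> \<pi> i \<in> supp d \<eta>)"
      using \<pi>_supp by simp
    also have "\<dots> \<longleftrightarrow> (\<forall>j\<in>\<pi> ` {1..d}. j \<in> supp d (scan \<omega>) \<longleftrightarrow> j \<in> supp d \<eta>)"
      by blast
    also have "\<pi> ` {1..d} = {1..d}" using \<pi> by (simp add: bij_betw_def)
    also have "(\<forall>j\<in>{1..d}. j \<in> supp d (scan \<omega>) \<longleftrightarrow> j \<in> supp d \<eta>)
        \<longleftrightarrow> supp d (scan \<omega>) = supp d \<eta>"
      by (rule supp_eq_iff[symmetric])
    finally show ?thesis .
  qed
  let ?A = "{\<omega> \<in> space sample_space. supp d (scan \<omega>) \<noteq> supp d ?e}"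
  have "err scan ?e = measure (distr (obs \<eta>) (obs ?e) T) ?A"
    unfolding distr by (simp add: error_prob_def)
  also have "\<dots> = measure (obs \<eta>) (T -` ?A \<inter> space (obs \<eta>))"
    using selector_measurable[OF scan_in_selectors] by (intro measure_distr T_meas) simp
  also have "T -` ?A \<inter> space (obs \<eta>) = {\<omega> \<in> space (obs \<eta>). supp d (scan \<omega>) \<noteq> supp d \<eta>}"
    using scan_T measurable_space[OF T_meas] by auto
  also have "measure (obs \<eta>) \<dots> = err scan \<eta>"
    by (simp add: error_prob_def)
  finally show ?thesis ..
qed

text \<open>Without ties exactly \<open>s\<close> indices are selected, so the selected set differs
  from \<open>{1..s}\<close> exactly when it misses one of these. With ties it may be strictly
  larger, hence the events are identified only almost surely.\<close>

lemma error_prob_scan_first_ones: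
  "err scan (first_ones d s) = measure (obs (first_ones d s))
     (\<Union>i\<in>{1..s}. {\<omega> \<in> space (obs (first_ones d s)).
        lik_ratio f0 f1 i \<omega> \<notin> top_lik_ratios f0 f1 d s \<omega>})"
proof -
  let ?e = "first_ones d s"
  interpret prob_space "obs ?e" by (rule prob_space_obs)
  have se: "supp d ?e = {1..s}" using s by (simp add: supp_first_ones)
  have miss: "(\<Union>i\<in>{1..s}. {\<omega> \<in> space (obs ?e). lik_ratio f0 f1 i \<omega> \<notin> top_lik_ratios f0 f1 d s \<omega>})
      = {\<omega> \<in> space sample_space. \<not> {1..s} \<subseteq> supp d (scan \<omega>)}"
  proof -
    have "lik_ratio f0 f1 i \<omega> \<in> top_lik_ratios f0 f1 d s \<omega> \<longleftrightarrow> i \<in> supp d (scan \<omega>)"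
      if "i \<in> {1..s}" for i and \<omega> :: "(nat \<Rightarrow> 'a) \<times> 'z"
      unfolding supp_scan using that s by (intro top_lik_ratios_iff) auto
    then show ?thesis by auto
  qed
  have "AE \<omega> in obs ?e. supp d (scan \<omega>) \<noteq> {1..s} \<longleftrightarrow> \<not> {1..s} \<subseteq> supp d (scan \<omega>)"
    using AE_no_ties[OF first_ones_sparse[OF less_imp_le[OF s(2)]]]
  proof eventually_elim
    case (elim \<omega>)
    have "card (supp d (scan \<omega>)) = card {1..s}"
      using scan_sparse[OF elim] by (simp add: sparse_vectors_def)
    moreover have "finite (supp d (scan \<omega>))" by (simp add: supp_def)
    ultimately show ?case using card_subset_eq[of "supp d (scan \<omega>)" "{1..s}"] by auto
  qed
  then show ?thesis
    unfolding error_prob_def miss se using selector_measurable[OF scan_in_selectors]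
    by (intro finite_measure_eq_AE) (auto elim: eventually_mono)
qed

end

section \<open>Bayes and minimax risk of the scan selector\<close>

theorem theorem5:
  fixes d s :: nat
    and \<mu> P0 P1 :: "'a measure" and f0 f1 :: "'a \<Rightarrow> real"
    and Z :: "'z measure"
  assumes "d > 2" and "1 \<le> s" and "s < d"
    and "prob_space P0" and "prob_space P1" and "P0 \<noteq> P1"
    and "f0 \<in> borel_measurable \<mu>" and "\<And>x. x \<in> space \<mu> \<Longrightarrow> 0 \<le> f0 x"
    and "P0 = density \<mu> (\<lambda>x. ennreal (f0 x))"
    and "f1 \<in> borel_measurable \<mu>" and "\<And>x. x \<in> space \<mu> \<Longrightarrow> 0 \<le> f1 x"
    and "P1 = density \<mu> (\<lambda>x. ennreal (f1 x))"
    and "prob_space Z"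
    and lik_ratio_well_defined:
      "\<And>\<eta>. \<eta> \<in> binary_vectors d \<Longrightarrow>
         AE \<omega> in obs_law P0 P1 Z d \<eta>. \<forall>i\<in>{1..d}. f0 (fst \<omega> i) \<noteq> 0"
    and no_ties:
      "\<And>\<eta>. \<eta> \<in> sparse_vectors d s \<Longrightarrow>
         \<P>(\<omega> in obs_law P0 P1 Z d \<eta>.
            \<forall>i\<in>{1..d}. \<forall>j\<in>{1..d}. i \<noteq> j \<longrightarrow> lik_ratio f0 f1 i \<omega> \<noteq> lik_ratio f0 f1 j \<omega>) = 1"
  shows "(INF h\<in>selectors \<mu> Z d. SUP \<eta>\<in>sparse_vectors d s. error_prob P0 P1 Z d h \<eta>)
           = (SUP \<eta>\<in>sparse_vectors d s. error_prob P0 P1 Z d (scan_selector f0 f1 d s) \<eta>)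
       \<and> (SUP \<eta>\<in>sparse_vectors d s. error_prob P0 P1 Z d (scan_selector f0 f1 d s) \<eta>)
           = error_prob P0 P1 Z d (scan_selector f0 f1 d s) (first_ones d s)
       \<and> (INF h\<in>selectors \<mu> Z d.
             measure_pmf.expectation (pmf_of_set (sparse_vectors d s)) (error_prob P0 P1 Z d h))
           = measure_pmf.expectation (pmf_of_set (sparse_vectors d s))
               (error_prob P0 P1 Z d (scan_selector f0 f1 d s))
       \<and> measure_pmf.expectation (pmf_of_set (sparse_vectors d s))
             (error_prob P0 P1 Z d (scan_selector f0 f1 d s))
           = error_prob P0 P1 Z d (scan_selector f0 f1 d s) (first_ones d s)
       \<and> error_prob P0 P1 Z d (scan_selector f0 f1 d s) (first_ones d s)
           = measure (obs_law P0 P1 Z d (first_ones d s))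
               (\<Union>i\<in>{1..s}. {\<omega> \<in> space (obs_law P0 P1 Z d (first_ones d s)).
                  lik_ratio f0 f1 i \<omega> \<notin> top_lik_ratios f0 f1 d s \<omega>})"
proof -
  interpret selection_model d s \<mu> P0 P1 f0 f1 Z
    by (rule selection_model.intro) (fact assms)+
  let ?S = "sparse_vectors d s"
  let ?avg = "\<lambda>h. measure_pmf.expectation (pmf_of_set ?S) (err h)"
  let ?c = "err scan (first_ones d s)"
  have ne: "?S \<noteq> {}" and card: "0 < card ?S"
    using first_ones_sparse[of s d] \<open>s < d\<close> by (auto simp: card_gt_0_iff)
  have avg: "?avg h = (\<Sum>\<eta>\<in>?S. err h \<eta>) / real (card ?S)" for h
    using ne by (intro integral_pmf_of_set) auto
  have scan_const: "err scan \<eta> = ?c" if "\<eta> \<in> ?S" for \<eta>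
    using that by (rule error_prob_scan_eq)
  have sup_scan: "(SUP \<eta>\<in>?S. err scan \<eta>) = ?c"
    using SUP_cong[OF refl scan_const] cSUP_const[OF ne] by (rule trans)
  have avg_scan: "?avg scan = ?c"
  proof -
    have "(\<Sum>\<eta>\<in>?S. err scan \<eta>) = (\<Sum>\<eta>\<in>?S. ?c)"
      using scan_const by (rule sum.cong[OF refl])
    then show ?thesis using ne card by (simp add: avg)
  qed
  \<comment> \<open>The scan selector has the least total error, and its average is
    \<open>?c\<close> because its error is the same for all sparse vectors.\<close>
  have c_le_avg: "?c \<le> ?avg h" if "h \<in> selectors \<mu> Z d" for h
    unfolding avg_scan[symmetric] avg
    using sum_error_prob_scan_le[OF that] by (intro divide_right_mono) simp_all
  have avg_le_sup: "?avg h \<le> (SUP \<eta>\<in>?S. err h \<eta>)" for h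
  proof -
    \<comment> \<open>The index set is finite, so the real supremum is a genuine upper
      bound.\<close>
    have "(\<Sum>\<eta>\<in>?S. err h \<eta>) \<le> real (card ?S) * (SUP \<eta>\<in>?S. err h \<eta>)"
      by (rule sum_bounded_above) (intro cSUP_upper bdd_above_finite finite_imageI, simp_all)
    then show ?thesis using card by (simp add: avg divide_le_eq mult.commute)
  qed
  \<comment> \<open>The uniform average bounds the supremum from below, so the Bayes bound is also a
    minimax bound; the scan selector attains it by its constant risk.\<close>
  have inf_sup: "(INF h\<in>selectors \<mu> Z d. SUP \<eta>\<in>?S. err h \<eta>) = ?c"
  proof (rule cInf_eq_minimum)
    show "?c \<in> (\<lambda>h. SUP \<eta>\<in>?S. err h \<eta>) ` selectors \<mu> Z d"
      using scan_in_selectors by (rule rev_image_eqI) (rule sup_scan[symmetric])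
    show "?c \<le> x" if "x \<in> (\<lambda>h. SUP \<eta>\<in>?S. err h \<eta>) ` selectors \<mu> Z d" for x
      using that order.trans[OF c_le_avg avg_le_sup] by blast
  qed
  have inf_avg: "(INF h\<in>selectors \<mu> Z d. ?avg h) = ?c"
  proof (rule cInf_eq_minimum)
    show "?c \<in> ?avg ` selectors \<mu> Z d"
      using scan_in_selectors by (rule rev_image_eqI) (rule avg_scan[symmetric])
    show "?c \<le> x" if "x \<in> ?avg ` selectors \<mu> Z d" for x
      using that c_le_avg by blast
  qed
  show ?thesis
    unfolding inf_sup inf_avg sup_scan avg_scan
    by (intro conjI refl error_prob_scan_first_ones)
qed

end
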